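(* Let $d=(d_1,\ldots,d_n)$ be a non-increasing sequence of positive integers such that $\sum_{i=1}^n d_i$ is an even number at most $2n-2$. If $\alpha^{\mathcal F}_{\max}(d)=n-k$, then there is a forest $F$ with vertex set $\{u_1,\ldots,u_n\}$ and $d_F(u_i)=d_i$ for every $i\in[n]$ such that (i) $I=\{u_{k+1},\ldots,u_n\}$ is an independent set in $F$, (ii) $\bar I=\{u_1,\ldots,u_k\}$ and $I$ are both dominating sets of $F$, and (iii) if $F[\bar I]$ has exactly $r$ isolated vertices for some $0\le r\le k$, then these are the vertices in $\{u_i:i\in[k]\setminus[k-r]\}$.
   Context: All graphs are finite, simple and undirected. $[m]=\{1,\ldots,m\}$ for a positive integer $m$, and $[0]=\emptyset$. $d_F(u)$ is the degree of $u$ in $F$, and $F[U]$ is the subgraph of $F$ induced by $U$. For a sequence $d$ of non-negative integers, $\mathcal{F}(d)$ is the set of all forests with degree sequence $d$. $\alpha(G)$ is the independence number of $G$, that is, the largest order of a set of pairwise non-adjacent vertices. $\alpha^{\mathcal F}_{\max}(d)=\max\{\alpha(F):F\in\mathcal{F}(d)\}$. (It is well known that a sequence $d$ as in the statement is the degree sequence of some forest, so this maximum exists.) A set $D$ of vertices of a graph $G$ is a dominating set if every vertex in $V(G)\setminus D$ has a neighbor in $D$. *)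

theory Defs
  imports "Graph_Theory.Pair_Digraph" "Graph_Theory.Digraph_Component" "HOL-Library.Multiset"
begin

text \<open>
  Finite simple undirected graphs are the \<^locale>\<open>graph\<close>s of the Graph-Theory library, that is,
  finite symmetric digraphs without loops and parallel arcs; an edge \<open>uv\<close> is the pair of arcs
  \<open>(u, v)\<close>, \<open>(v, u)\<close>.
\<close>

text \<open>The two arcs of an edge each leave exactly one of its ends, so \<^const>\<open>out_degree\<close> counts
  every incident edge once.\<close>
abbreviation degree :: "('a, 'b) pre_digraph \<Rightarrow> 'a \<Rightarrow> nat" where
  "degree G u \<equiv> out_degree G u"

text \<open>The library's \<^const>\<open>forest\<close> regards \<open>u, v, u\<close> as a cycle, so it rejects every symmetric
  digraph with an arc. The cycles of the undirected graph are those of length at least three.\<close>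
definition undirected_forest :: "('a, 'b) pre_digraph \<Rightarrow> bool" where
  "undirected_forest G \<longleftrightarrow> graph G \<and> \<not> (\<exists>p. pre_digraph.cycle G p \<and> 3 \<le> length p)"

definition independent_set :: "('a, 'b) pre_digraph \<Rightarrow> 'a set \<Rightarrow> bool" where
  "independent_set G S \<longleftrightarrow> S \<subseteq> verts G \<and> (\<forall>u\<in>S. \<forall>v\<in>S. \<not> u \<rightarrow>\<^bsub>G\<^esub> v)"

definition independence_number :: "('a, 'b) pre_digraph \<Rightarrow> nat" where
  "independence_number G = Max (card ` {S. independent_set G S})"

definition dominating_set :: "('a, 'b) pre_digraph \<Rightarrow> 'a set \<Rightarrow> bool" where
  "dominating_set G D \<longleftrightarrow> D \<subseteq> verts G \<and> (\<forall>u\<in>verts G - D. \<exists>v\<in>D. u \<rightarrow>\<^bsub>G\<^esub> v)"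

definition isolated_vertices :: "('a, 'b) pre_digraph \<Rightarrow> 'a set" where
  "isolated_vertices G = {u \<in> verts G. degree G u = 0}"

text \<open>The forests with degree sequence \<open>d 1, \<dots>, d n\<close>. Degree sequences are compared as multisets.
  Vertices are natural numbers, which covers all finite graphs up to isomorphism.\<close>
definition forests_of :: "nat \<Rightarrow> (nat \<Rightarrow> nat) \<Rightarrow> nat pair_pre_digraph set" where
  "forests_of n d = {F. undirected_forest (with_proj F) \<and>
     image_mset (degree (with_proj F)) (mset_set (pverts F)) = image_mset d (mset_set {1..n})}"

text \<open>\<^const>\<open>forests_of\<close> may be infinite, but every independence number in question is at most \<open>n\<close>,
  so the maximum is over a finite set.\<close>
definition alpha_max :: "nat \<Rightarrow> (nat \<Rightarrow> nat) \<Rightarrow> nat" where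
  "alpha_max n d = Max ((\<lambda>F. independence_number (with_proj F)) ` forests_of n d)"

end

theory Submission
  imports Defs
begin

text \<open>
  Let \<open>2M\<close> be the sum of the degrees. If a graph with these degrees has an independent set \<open>S\<close>, the
  degrees outside \<open>S\<close> sum to at least those in \<open>S\<close>, so the \<open>n - \<bar>S\<bar>\<close> largest degrees sum to at
  least \<open>M\<close>. Let \<open>m\<close> be minimal such that \<open>d 1 + \<dots> + d m \<ge> M\<close>, and let \<open>h\<close> be the excess. Then
  \<open>\<alpha>\<^sub>m\<^sub>a\<^sub>x \<le> n - m\<close>, and it suffices to construct the required forest for \<open>k = m\<close>. In it the first
  \<open>m\<close> vertices must span exactly \<open>h\<close> edges. Minimality of \<open>m\<close> gives \<open>h < d m\<close>, so these edges can be
  chosen as a star with centre \<open>1\<close> and leaves \<open>2, \<dots>, h + 1\<close>, which uses only the largest degrees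
  and leaves at least one unused degree at every vertex. After contraction of the star, the
  remaining degrees are positive, balanced between the two sides and small enough in sum to be
  realised by a bipartite forest, built by removing leaves.
\<close>

section \<open>Forests as sparse relations\<close>

text \<open>Every edge \<open>uv\<close> counts twice, as \<open>(u, v)\<close> and \<open>(v, u)\<close>: a symmetric relation is the arc set of
  a forest iff every nonempty set \<open>W\<close> of vertices spans at most \<open>\<bar>W\<bar> - 1\<close> edges.\<close>
definition sparse :: "'a set \<Rightarrow> 'a rel \<Rightarrow> bool" where
  "sparse V R \<longleftrightarrow> (\<forall>W\<subseteq>V. W \<noteq> {} \<longrightarrow> card (R \<inter> W \<times> W) + 2 \<le> 2 * card W)"

lemma sparse_empty: "sparse {} R"
  by (simp add: sparse_def)

text \<open>If \<open>W\<close> meets both \<open>A\<close> and \<open>B\<close>, the two parts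
  together leave four arcs of slack, and the at most two arcs of \<open>Q\<close> use up only half
  of it. Hence joining two forests by one edge, or by none when \<open>Q\<close> is empty, yields a
  forest.\<close>

lemma sparse_link:
  assumes "finite A" "finite B" "A \<inter> B = {}" "sparse A R" "sparse B S"
    and "R \<subseteq> A \<times> A" "S \<subseteq> B \<times> B" "Q \<subseteq> A \<times> B \<union> B \<times> A" "card Q \<le> 2"
  shows "sparse (A \<union> B) (R \<union> S \<union> Q)"
  unfolding sparse_def
proof (intro allI impI)
  fix W assume W: "W \<subseteq> A \<union> B" "W \<noteq> {}"
  define X Y where "X = W \<inter> A" and "Y = W \<inter> B"
  have fin: "finite X" "finite Y" "finite Q"
    using assms(1,2,8) by (auto simp: X_def Y_def intro: finite_subset)
  have card_W: "card W = card X + card Y"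
    using W fin assms(3) by (subst card_Un_disjoint[symmetric]) (auto simp: X_def Y_def intro!: arg_cong[of _ _ card])
  have sX: "X \<noteq> {} \<Longrightarrow> card (R \<inter> X \<times> X) + 2 \<le> 2 * card X"
    and sY: "Y \<noteq> {} \<Longrightarrow> card (S \<inter> Y \<times> Y) + 2 \<le> 2 * card Y"
    using assms(4,5) by (auto simp: sparse_def X_def Y_def)
  consider "X = {}" "Y \<noteq> {}" | "X \<noteq> {}" "Y = {}" | "X \<noteq> {}" "Y \<noteq> {}"
    using W by (auto simp: X_def Y_def)
  then show "card ((R \<union> S \<union> Q) \<inter> W \<times> W) + 2 \<le> 2 * card W"
  proof cases
    case 1
    then have "(R \<union> S \<union> Q) \<inter> W \<times> W = S \<inter> Y \<times> Y"
      using assms(6-8) W by (auto simp: X_def Y_def)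
    then show ?thesis using sY 1 card_W by simp
  next
    case 2
    then have "(R \<union> S \<union> Q) \<inter> W \<times> W = R \<inter> X \<times> X"
      using assms(6-8) W by (auto simp: X_def Y_def)
    then show ?thesis using sX 2 card_W by simp
  next
    case 3
    have "(R \<union> S \<union> Q) \<inter> W \<times> W \<subseteq> (R \<inter> X \<times> X) \<union> (S \<inter> Y \<times> Y) \<union> Q"
      using assms(6,7) by (auto simp: X_def Y_def)
    then have "card ((R \<union> S \<union> Q) \<inter> W \<times> W) \<le> card ((R \<inter> X \<times> X) \<union> (S \<inter> Y \<times> Y) \<union> Q)"
      using fin by (intro card_mono) auto
    also have "\<dots> \<le> card (R \<inter> X \<times> X) + card (S \<inter> Y \<times> Y) + card Q"
      by (meson add_le_mono1 card_Un_le order_trans)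
    finally show ?thesis using sX sY 3 card_W assms(9) by linarith
  qed
qed

text \<open>Arcs occur inside \<open>W\<close> only if \<open>a\<close> is in \<open>W\<close>, and
  then each of the other \<open>card W - 1\<close> vertices contributes at most two. As
  \<open>L\<close> may reach beyond \<open>V\<close>, the same star can be tested against any
  block.\<close>

lemma sparse_star:
  assumes "finite V" "a \<notin> L"
  shows "sparse V ({a} \<times> L \<union> L \<times> {a})"
  unfolding sparse_def
proof (intro allI impI)
  fix W assume W: "W \<subseteq> V" "W \<noteq> {}"
  then have "finite W" using assms(1) finite_subset by blast
  then have W1: "card W \<ge> 1" using W by (simp add: Suc_leI card_gt_0_iff)
  show "card (({a} \<times> L \<union> L \<times> {a}) \<inter> W \<times> W) + 2 \<le> 2 * card W"
  proof (cases "a \<in> W")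
    case True
    have "({a} \<times> L \<union> L \<times> {a}) \<inter> W \<times> W \<subseteq> {a} \<times> (W - {a}) \<union> (W - {a}) \<times> {a}"
      using assms(2) by auto
    then have "card (({a} \<times> L \<union> L \<times> {a}) \<inter> W \<times> W)
        \<le> card ({a} \<times> (W - {a}) \<union> (W - {a}) \<times> {a})"
      using \<open>finite W\<close> by (intro card_mono) auto
    also have "\<dots> \<le> card (W - {a}) + card (W - {a})"
      by (rule order_trans[OF card_Un_le]) (simp add: card_cartesian_product)
    finally show ?thesis using True \<open>finite W\<close> W1 by simp
  next
    case False
    then have "({a} \<times> L \<union> L \<times> {a}) \<inter> W \<times> W = {}" by auto
    then show ?thesis using W1 by simp
  qed
qed

lemma pcas_nth:
  assumes "pcas u p v"
  shows "i + 1 < length p \<Longrightarrow> fst (p ! (i + 1)) = snd (p ! i)"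
    and "p \<noteq> [] \<Longrightarrow> fst (p ! 0) = snd (p ! (length p - 1)) \<longleftrightarrow> u = v"
proof -
  show "i + 1 < length p \<Longrightarrow> fst (p ! (i + 1)) = snd (p ! i)"
    using assms
  proof (induction p arbitrary: u i)
    case (Cons e p)
    then show ?case by (cases i; cases p) auto
  qed simp
  have "p \<noteq> [] \<Longrightarrow> fst (p ! 0) = u \<and> snd (p ! (length p - 1)) = v"
    using assms
  proof (induction p arbitrary: u)
    case (Cons e p)
    then show ?case by (cases p) auto
  qed simp
  then show "p \<noteq> [] \<Longrightarrow> fst (p ! 0) = snd (p ! (length p - 1)) \<longleftrightarrow> u = v"
    by auto
qed

text \<open>A cycle of length \<open>N\<close> visits a set \<open>W\<close> of \<open>N\<close>
  vertices. If \<open>N\<close> is at least 3, its arcs and their reversals are \<open>2 * N\<close>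
  distinct arcs inside \<open>W\<close>, whereas sparseness allows only
  \<open>2 * N - 2\<close>.\<close>

lemma sparse_imp_no_long_cycle:
  assumes "sym (parcs G)" "sparse (pverts G) (parcs G)" "finite (parcs G)" "parcs G \<subseteq> pverts G \<times> pverts G"
    and "pre_digraph.cycle (with_proj G) p"
  shows "length p \<le> 2"
proof (rule ccontr)
  define N where "N = length p"
  define W where "W = snd ` set p"
  assume "\<not> length p \<le> 2"
  then have N: "N \<ge> 3" by (simp add: N_def)
  obtain u where u: "set p \<subseteq> parcs G" "pcas u p u" "distinct (tl (pawalk_verts u p))" "p \<noteq> []"
    using assms(5)
    by (auto simp: pre_digraph.cycle_def pre_digraph.awalk_def cas_with_proj_eq awalk_verts_with_proj_eq)
  \<comment> \<open>Without its first entry, the vertex list of the walk consists of the heads of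
    its arcs, so the cycle condition says that the heads are distinct.\<close>
  have "pawalk_verts u p = fst (hd p) # map snd p"
    using pre_digraph.awalk_verts_conv'[of "with_proj G" u p u] u
    by (simp add: cas_with_proj_eq awalk_verts_with_proj_eq)
  then have dist: "distinct (map snd p)" using u by simp
  then have snd_inj: "i = j" if "snd (p ! i) = snd (p ! j)" "i < N" "j < N" for i j
    using that by (auto simp: distinct_conv_nth N_def)
  have next_arc: "fst (p ! ((i + 1) mod N)) = snd (p ! i)" if "i < N" for i
  proof (cases "i + 1 < N")
    case True
    then show ?thesis using pcas_nth(1)[OF u(2)] by (simp add: N_def)
  next
    case False
    then have "i = N - 1" "i + 1 = N" using that by auto
    then show ?thesis using pcas_nth(2)[OF u(2,4)] by (simp add: N_def)
  qed
  have pred: "\<exists>j<N. e = p ! ((j + 1) mod N)" if e: "e \<in> set p" for e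
  proof -
    obtain i where i: "i < N" "e = p ! i" using e by (metis in_set_conv_nth N_def)
    show ?thesis
    proof (cases i)
      case 0
      then show ?thesis using i N by (intro exI[of _ "N - 1"]) auto
    next
      case (Suc j)
      then show ?thesis using i by (intro exI[of _ j]) auto
    qed
  qed
  have pW: "set p \<subseteq> W \<times> W"
  proof
    fix e assume e: "e \<in> set p"
    from pred[OF e] obtain j where "j < N" "fst e = snd (p ! j)" using next_arc by auto
    then have "fst e \<in> W" by (auto simp: W_def N_def)
    moreover have "snd e \<in> W" using e by (auto simp: W_def)
    ultimately show "e \<in> W \<times> W" by (cases e) auto
  qed
  \<comment> \<open>If an arc and its reversal both occurred, distinctness of the heads would make
    the arcs preceding them cyclic successors of each other, which is impossible for
    \<open>N\<close> at least 3.\<close>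
  have no_rev: "set p \<inter> (set p)\<inverse> = {}"
  proof (rule ccontr)
    assume "\<not> ?thesis"
    then obtain a b where ab: "(a, b) \<in> set p" "(b, a) \<in> set p" by auto
    then obtain i j where ij: "i < N" "j < N" "p ! ((i + 1) mod N) = (a, b)" "p ! ((j + 1) mod N) = (b, a)"
      using pred by metis
    then have "snd (p ! i) = snd (p ! ((j + 1) mod N))" "snd (p ! j) = snd (p ! ((i + 1) mod N))"
      using next_arc[of i] next_arc[of j] by auto
    then have "i = (j + 1) mod N" "j = (i + 1) mod N"
      using ij N by (auto intro!: snd_inj)
    moreover have "(k + 1) mod N = (if k + 1 = N then 0 else k + 1)" if "k < N" for k
      using that by simp
    ultimately have "i = (if j + 1 = N then 0 else j + 1)" "j = (if i + 1 = N then 0 else i + 1)"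
      using ij(1,2) by metis+
    then show False using N by presburger
  qed
  have "card (set p) = N" "card W = N"
    using dist by (auto simp: N_def W_def distinct_card distinct_map card_image)
  moreover have "card (set p \<union> (set p)\<inverse>) = card (set p) + card ((set p)\<inverse>)"
    using no_rev by (intro card_Un_disjoint) auto
  moreover have "card (set p \<union> (set p)\<inverse>) \<le> card (parcs G \<inter> W \<times> W)"
    using pW u(1) assms(1,3) by (intro card_mono) (auto dest: symD)
  moreover have "card (parcs G \<inter> W \<times> W) + 2 \<le> 2 * card W"
  proof -
    have "snd ` set p \<subseteq> snd ` (pverts G \<times> pverts G)"
      using assms(4) u(1) by (intro image_mono) (rule order_trans)
    then have "W \<subseteq> pverts G" "W \<noteq> {}" using u(4) by (auto simp: W_def)
    then show ?thesis using assms(2) unfolding sparse_def by blast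
  qed
  ultimately show False by simp
qed

section \<open>Bipartite completion of a forest\<close>

text \<open>The function \<open>s\<close> gives the side of a vertex, \<open>1\<close> or \<open>- 1\<close>, and \<open>c\<close> the number of edges it still
  needs to the other side. The blocks in \<open>P\<close> are the vertex sets of the trees to be joined.\<close>
lemma opposite_blocks:
  fixes P :: "'a set set" and s :: "'a \<Rightarrow> int" and c :: "'a \<Rightarrow> nat"
  assumes "finite P" "P \<noteq> {}" "\<And>B. B \<in> P \<Longrightarrow> finite B" "pairwise disjnt P"
    and s: "\<And>B u v. B \<in> P \<Longrightarrow> u \<in> B \<Longrightarrow> v \<in> B \<Longrightarrow> s u = s v" "\<And>v. \<bar>s v\<bar> = 1"
    and pos: "\<And>B. B \<in> P \<Longrightarrow> 1 \<le> sum c B"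
    and bal: "(\<Sum>v\<in>\<Union>P. s v * int (c v)) = 0"
    and bound: "sum c (\<Union>P) < 2 * card P"
  shows "\<exists>L\<in>P. \<exists>M\<in>P. sum c L = 1 \<and> (\<forall>x\<in>L. \<forall>y\<in>M. s x + s y = 0) \<and>
    (2 \<le> sum c M \<or> (\<forall>B\<in>P. sum c B = 1))"
proof -
  have sum_P: "sum c (\<Union>P) = (\<Sum>B\<in>P. sum c B)"
    using assms(3,4) by (subst sum.Union_disjoint) (auto simp: pairwise_def disjnt_def)
  \<comment> \<open>Averaging: the total demand is below two per block.\<close>
  have "\<exists>L\<in>P. sum c L = 1"
  proof (rule ccontr)
    assume "\<not> ?thesis"
    then have "2 \<le> sum c B" if "B \<in> P" for B
      using pos[OF that] that by (metis One_nat_def Suc_1 le_antisym not_less_eq_eq)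
    then have "(\<Sum>B\<in>P. 2) \<le> (\<Sum>B\<in>P. sum c B)" by (intro sum_mono) auto
    then show False using bound sum_P by simp
  qed
  then obtain L where L: "L \<in> P" "sum c L = 1" by auto
  then obtain x where x: "x \<in> L" by fastforce
  have opp_iff: "s u + s v = 0 \<longleftrightarrow> s u \<noteq> s v" for u v
    using s(2)[of u] s(2)[of v] by linarith
  \<comment> \<open>If all vertices were on the side of \<open>x\<close>, the signed sum would be
    the positive total demand up to sign, not zero.\<close>
  have "\<exists>y\<in>\<Union>P. s x + s y = 0"
  proof (rule ccontr)
    assume "\<not> ?thesis"
    then have "(\<Sum>v\<in>\<Union>P. s v * int (c v)) = (\<Sum>v\<in>\<Union>P. s x * int (c v))"
      by (intro sum.cong) (auto simp: opp_iff)
    then have "s x * int (sum c (\<Union>P)) = 0" using bal by (simp add: sum_distrib_left)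
    then have "sum c (\<Union>P) = 0" using s(2)[of x] by (auto simp del: of_nat_sum)
    then show False using L sum_P assms(1) by simp
  qed
  then obtain y M where M: "M \<in> P" "y \<in> M" "s x + s y = 0" by auto
  have LM: "s u + s v = 0" if "u \<in> L" "v \<in> M" for u v
    using s(1)[OF L(1) that(1) x] s(1)[OF M(1) that(2) M(2)] M(3) by simp
  show ?thesis
  proof (cases "2 \<le> sum c M \<or> (\<forall>B\<in>P. sum c B = 1)")
    case True
    then show ?thesis using L M(1) LM by blast
  next
    \<comment> \<open>Now \<open>L\<close> and \<open>M\<close> both have demand one and lie on
      opposite sides, so a block \<open>N\<close> of larger demand is opposite to one of them. That
      one becomes the leaf block.\<close>
    case False
    then obtain N where N: "N \<in> P" "2 \<le> sum c N" using pos
      by (metis One_nat_def Suc_1 le_antisym not_less_eq_eq)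
    then obtain z where z: "z \<in> N" by fastforce
    have M1: "sum c M = 1" using False pos[OF M(1)] by simp
    show ?thesis
    proof (cases "s x + s z = 0")
      case True
      have "s u + s v = 0" if "u \<in> L" "v \<in> N" for u v
        using s(1)[OF L(1) that(1) x] s(1)[OF N(1) that(2) z] True by simp
      then show ?thesis using L N by blast
    next
      case False
      then have "s y + s z = 0" using M(3) by (auto simp: opp_iff)
      then have "s u + s v = 0" if "u \<in> M" "v \<in> N" for u v
        using s(1)[OF M(1) that(1) M(2)] s(1)[OF N(1) that(2) z] by simp
      then show ?thesis using M(1) N M1 by blast
    qed
  qed
qed

text \<open>Induction on the number of blocks: a block of demand one becomes a leaf, attached by a
  single edge to a block on the other side. The last hypothesis says that at most
  \<open>card P - 1\<close> edges are to be added, as a forest on the contracted blocks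
  requires.\<close>

lemma bipartite_completion:
  fixes P :: "'a set set" and s :: "'a \<Rightarrow> int" and c :: "'a \<Rightarrow> nat" and R :: "'a rel"
  assumes "finite P" "\<And>B. B \<in> P \<Longrightarrow> finite B" "pairwise disjnt P"
    and "\<And>B. B \<in> P \<Longrightarrow> sparse B (R \<inter> B \<times> B)"
    and "\<And>B u v. B \<in> P \<Longrightarrow> u \<in> B \<Longrightarrow> v \<in> B \<Longrightarrow> s u = s v" "\<And>v. \<bar>s v\<bar> = 1"
    and "\<And>B. B \<in> P \<Longrightarrow> 1 \<le> sum c B"
    and "(\<Sum>v\<in>\<Union>P. s v * int (c v)) = 0"
    and "P \<noteq> {} \<Longrightarrow> sum c (\<Union>P) + 2 \<le> 2 * card P"
  shows "\<exists>X. X \<subseteq> \<Union>P \<times> \<Union>P \<and> sym X \<and> (\<forall>(u, v)\<in>X. s u + s v = 0) \<and>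
    (\<forall>v\<in>\<Union>P. card (X `` {v}) = c v) \<and> sparse (\<Union>P) ((\<Union>B\<in>P. R \<inter> B \<times> B) \<union> X)"
  using assms
proof (induction "card P" arbitrary: P c rule: less_induct)
  case less
  note finP = less.prems(1) and finB = less.prems(2) and disj = less.prems(3) and sp = less.prems(4)
    and s = less.prems(5,6) and pos = less.prems(7) and bal = less.prems(8) and bound = less.prems(9)
  show ?case
  proof (cases "P = {}")
    case True
    then show ?thesis by (auto simp: sparse_empty sym_def)
  next
    case False
    have lt: "sum c (\<Union>P) < 2 * card P" using bound[OF False] by simp
    have "\<exists>L\<in>P. \<exists>M\<in>P. sum c L = 1 \<and> (\<forall>x\<in>L. \<forall>y\<in>M. s x + s y = 0) \<and>
        (2 \<le> sum c M \<or> (\<forall>B\<in>P. sum c B = 1))"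
      by (rule opposite_blocks) (fact finP False finB disj s pos bal lt)+
    then obtain L M where LM: "L \<in> P" "M \<in> P" "sum c L = 1"
      and opp: "\<And>x y. x \<in> L \<Longrightarrow> y \<in> M \<Longrightarrow> s x + s y = 0"
      and M: "2 \<le> sum c M \<or> (\<forall>B\<in>P. sum c B = 1)"
      by blast
    have "finite L" "finite M" using LM finB by auto
    obtain x where x: "x \<in> L" "c x = 1" and "\<forall>z\<in>L. x \<noteq> z \<longrightarrow> c z = 0"
      using iffD1[OF sum_eq_1_iff[OF \<open>finite L\<close>] LM(3)] by blast
    then have L0: "c z = 0" if "z \<in> L" "z \<noteq> x" for z using that by metis
    have "sum c M \<noteq> 0" using pos[OF LM(2)] by simp
    then obtain y where y: "y \<in> M" "1 \<le> c y" by (metis One_nat_def Suc_leI gr0I sum.neutral)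
    have sxy: "s x + s y = 0" using opp x(1) y(1) .
    have "L \<noteq> M"
    proof
      assume "L = M"
      then have "s x = s y" using s(1)[OF LM(1) x(1)] y(1) by simp
      then show False using sxy s(2)[of x] by simp
    qed
    define V where "V = \<Union>(P - {L})"
    have disj_B: "A \<inter> B = {}" if "A \<in> P" "B \<in> P" "A \<noteq> B" for A B
      using disj that by (auto simp: pairwise_def disjnt_def)
    have "V \<inter> L = {}" using disj_B[OF _ LM(1)] by (auto simp: V_def)
    have "\<Union>P = L \<union> V" using LM by (auto simp: V_def)
    have "finite V" using finP finB by (auto simp: V_def)
    have "M \<subseteq> V" using LM \<open>L \<noteq> M\<close> by (auto simp: V_def)
    have card_P: "card P = Suc (card (P - {L}))" using LM finP by (metis card.remove)
    have sum_P: "sum f (\<Union>P) = sum f L + sum f V" for f :: "'a \<Rightarrow> int"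
      unfolding \<open>\<Union>P = L \<union> V\<close> using \<open>V \<inter> L = {}\<close> \<open>finite L\<close> \<open>finite V\<close>
      by (intro sum.union_disjoint) auto
    have sum_P_nat: "sum f (\<Union>P) = sum f L + sum f V" for f :: "'a \<Rightarrow> nat"
      unfolding \<open>\<Union>P = L \<union> V\<close> using \<open>V \<inter> L = {}\<close> \<open>finite L\<close> \<open>finite V\<close>
      by (intro sum.union_disjoint) auto
    \<comment> \<open>This is the demand on \<open>V\<close> once the edge \<open>xy\<close> is
      reserved; \<open>x\<close> itself leaves with the block \<open>L\<close>.\<close>
    define c' where "c' = c(y := c y - 1)"
    have upd: "sum (\<lambda>v. s v * int (c' v)) A = sum (\<lambda>v. s v * int (c v)) A - s y"
      "sum c' A = sum c A - 1" "sum c A \<ge> 1" if "finite A" "y \<in> A" for A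
    proof -
      have "sum (\<lambda>v. s v * int (c' v)) (A - {y}) = sum (\<lambda>v. s v * int (c v)) (A - {y})"
        "sum c' (A - {y}) = sum c (A - {y})"
        by (auto simp: c'_def intro!: sum.cong)
      then show "sum (\<lambda>v. s v * int (c' v)) A = sum (\<lambda>v. s v * int (c v)) A - s y"
         "sum c' A = sum c A - 1" "sum c A \<ge> 1"
        using y(2) sum.remove[OF that, of "\<lambda>v. s v * int (c v)"] sum.remove[OF that, of c]
          sum.remove[OF that, of "\<lambda>v. s v * int (c' v)"] sum.remove[OF that, of c']
        by (auto simp: c'_def algebra_simps of_nat_diff)
    qed
    have sum_L: "(\<Sum>v\<in>L. s v * int (c v)) = s x"
      using sum.remove[OF \<open>finite L\<close> x(1), of "\<lambda>v. s v * int (c v)"] x L0 by simp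
    have "y \<in> V" using \<open>M \<subseteq> V\<close> y by auto
    \<comment> \<open>The leaf block \<open>L\<close> is to be attached by the edge \<open>xy\<close>. If this uses up all demand of \<open>M\<close>,
      then every block has demand one, and the matched pair \<open>L\<close>, \<open>M\<close> is removed together, since the
      induction hypothesis requires positive demands.\<close>
    have "\<exists>X. X \<subseteq> V \<times> V \<and> sym X \<and> (\<forall>(u, v)\<in>X. s u + s v = 0) \<and>
      (\<forall>v\<in>V. card (X `` {v}) = c' v) \<and> sparse V ((\<Union>B\<in>P - {L}. R \<inter> B \<times> B) \<union> X)"
    proof (cases "2 \<le> sum c M")
      case True
      show ?thesis
        unfolding V_def
      proof (rule less.hyps)
        show "card (P - {L}) < card P" using card_P by simp
        show "pairwise disjnt (P - {L})" using disj by (simp add: pairwise_def)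
        show "1 \<le> sum c' B" if "B \<in> P - {L}" for B
        proof (cases "B = M")
          case True
          then show ?thesis using upd(2)[OF \<open>finite M\<close> y(1)] \<open>2 \<le> sum c M\<close> by simp
        next
          case False
          then have "y \<notin> B" using disj_B[of B M] that LM y by auto
          then have "sum c' B = sum c B" by (auto simp: c'_def intro!: sum.cong)
          then show ?thesis using pos that by simp
        qed
        show "(\<Sum>v\<in>\<Union>(P - {L}). s v * int (c' v)) = 0"
          using upd(1)[OF \<open>finite V\<close> \<open>y \<in> V\<close>] bal sum_P sum_L sxy by (simp add: V_def)
        \<comment> \<open>The edge \<open>xy\<close> takes one unit of demand at each end and one
          block disappears, so both sides drop by two.\<close>
        show "sum c' (\<Union>(P - {L})) + 2 \<le> 2 * card (P - {L})"
          using upd(2,3)[OF \<open>finite V\<close> \<open>y \<in> V\<close>] bound[OF False] sum_P_nat[of c] LM(3) card_P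
          by (simp add: V_def)
        show "finite (P - {L})" using finP by (simp)
        show "finite B" "sparse B (R \<inter> B \<times> B)" if "B \<in> (P - {L})" for B
          using finB sp that by (simp_all)
        show "s u = s v" if "B \<in> (P - {L})" "u \<in> B" "v \<in> B" for B u v
          using s(1)[of B u v] that by blast
        show "\<bar>s v\<bar> = 1" for v by (rule s(2))
      qed
    next
      case False
      define P2 U where "P2 = P - {L, M}" and "U = \<Union>P2"
      have all1: "sum c B = 1" if "B \<in> P" for B using False M that by auto
      have "U \<inter> M = {}" using disj_B[OF _ LM(2)] by (auto simp: U_def P2_def)
      have "V = M \<union> U" using LM \<open>L \<noteq> M\<close> by (auto simp: V_def U_def P2_def)
      have "finite U" using \<open>finite V\<close> \<open>V = M \<union> U\<close> by simp
      have zero: "c' v = 0" if "v \<in> M" for v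
        using upd(2)[OF \<open>finite M\<close> y(1)] all1[OF LM(2)] that \<open>finite M\<close> by simp
      have same: "c' v = c v" if "v \<in> U" for v
        using that \<open>U \<inter> M = {}\<close> y(1) by (auto simp: c'_def)
      have sum_c: "sum c (\<Union>Q) = card Q" if "Q \<subseteq> P" for Q
      proof -
        have "\<forall>A\<in>Q. finite A" "\<forall>A\<in>Q. \<forall>B\<in>Q. A \<noteq> B \<longrightarrow> A \<inter> B = {}"
          using that finB disj_B by blast+
        from sum.Union_disjoint[OF this, of c]
        have "sum c (\<Union>Q) = (\<Sum>B\<in>Q. sum c B)" by simp
        also have "\<dots> = (\<Sum>B\<in>Q. 1)" by (rule sum.cong[OF refl]) (use that all1 in blast)
        finally show ?thesis by simp
      qed
      have "(\<Sum>v\<in>V. s v * int (c' v)) = (\<Sum>v\<in>M. s v * int (c' v)) + (\<Sum>v\<in>U. s v * int (c' v))"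
        using \<open>V = M \<union> U\<close> \<open>finite M\<close> \<open>finite U\<close> \<open>U \<inter> M = {}\<close> by (simp add: sum.union_disjoint inf_commute)
      also have "\<dots> = (\<Sum>v\<in>U. s v * int (c v))" using zero same by simp
      finally have bal2: "(\<Sum>v\<in>U. s v * int (c v)) = 0"
        using upd(1)[OF \<open>finite V\<close> \<open>y \<in> V\<close>] bal sum_P sum_L sxy by simp
      have "\<exists>X. X \<subseteq> \<Union>P2 \<times> \<Union>P2 \<and> sym X \<and> (\<forall>(u, v)\<in>X. s u + s v = 0) \<and>
        (\<forall>v\<in>\<Union>P2. card (X `` {v}) = c v) \<and> sparse (\<Union>P2) ((\<Union>B\<in>P2. R \<inter> B \<times> B) \<union> X)"
      proof (rule less.hyps)
        show "card P2 < card P" using LM finP unfolding P2_def by (intro psubset_card_mono) auto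
        show "pairwise disjnt P2" using disj by (simp add: pairwise_def P2_def)
        show "(\<Sum>v\<in>\<Union>P2. s v * int (c v)) = 0" using bal2 by (simp add: U_def)
        \<comment> \<open>With demand one everywhere the total is \<open>card P2\<close>, so the
          bound asks for at least two blocks. A single block would have signed demand 1 or -1,
          against the balance.\<close>
        show "sum c (\<Union>P2) + 2 \<le> 2 * card P2" if "P2 \<noteq> {}"
        proof -
          have "\<not> card P2 = 1"
          proof
            assume "card P2 = 1"
            then obtain B where "P2 = {B}" by (auto simp: card_1_singleton_iff)
            then have "U = B" "B \<in> P" by (auto simp: U_def P2_def)
            then obtain z where z: "z \<in> B" using all1 by fastforce
            have "(\<Sum>v\<in>U. s v * int (c v)) = (\<Sum>v\<in>U. s z * int (c v))"
              by (rule sum.cong[OF refl]) (metis s(1) \<open>B \<in> P\<close> z \<open>U = B\<close>)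
            also have "\<dots> = s z * int (sum c U)" by (simp add: sum_distrib_left)
            also have "\<dots> = s z" using all1 \<open>B \<in> P\<close> \<open>U = B\<close> by simp
            finally show False using bal2 s(2)[of z] by simp
          qed
          moreover have "card P2 > 0" using that finP by (simp add: P2_def card_gt_0_iff)
          ultimately show ?thesis using sum_c[of P2] by (auto simp: P2_def)
        qed
        show "finite P2" using finP by (simp add: P2_def)
        show "finite B" "sparse B (R \<inter> B \<times> B)" if "B \<in> P2" for B
          using finB sp that by (simp_all add: P2_def)
        show "s u = s v" if "B \<in> P2" "u \<in> B" "v \<in> B" for B u v
          using s(1)[of B u v] that unfolding P2_def by blast
        show "\<bar>s v\<bar> = 1" for v by (rule s(2))
        show "1 \<le> sum c B" if "B \<in> P2" for B using pos that by (simp add: P2_def)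
      qed
      then obtain X where X: "X \<subseteq> U \<times> U" "sym X" "\<forall>(u, v)\<in>X. s u + s v = 0"
        "\<forall>v\<in>U. card (X `` {v}) = c v" "sparse U ((\<Union>B\<in>P2. R \<inter> B \<times> B) \<union> X)"
        unfolding U_def by blast
      \<comment> \<open>The block \<open>M\<close> returns without a linking edge, since its only
        new edge is the one to \<open>L\<close>.\<close>
      have "sparse (M \<union> U) (R \<inter> M \<times> M \<union> ((\<Union>B\<in>P2. R \<inter> B \<times> B) \<union> X) \<union> {})"
        by (rule sparse_link)
          (use \<open>finite M\<close> \<open>finite U\<close> \<open>U \<inter> M = {}\<close> sp[OF LM(2)] X in \<open>auto simp: U_def\<close>)
      moreover have "R \<inter> M \<times> M \<union> ((\<Union>B\<in>P2. R \<inter> B \<times> B) \<union> X) \<union> {} = (\<Union>B\<in>P - {L}. R \<inter> B \<times> B) \<union> X"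
        using LM \<open>L \<noteq> M\<close> by (auto simp: P2_def)
      ultimately have "sparse V ((\<Union>B\<in>P - {L}. R \<inter> B \<times> B) \<union> X)"
        using \<open>V = M \<union> U\<close> by simp
      moreover have "card (X `` {v}) = c' v" if "v \<in> V" for v
      proof (cases "v \<in> U")
        case True
        then show ?thesis using X(4) same by simp
      next
        case False
        then have "X `` {v} = {}" using X(1) by auto
        then show ?thesis using False that zero \<open>V = M \<union> U\<close> by auto
      qed
      ultimately show ?thesis using X \<open>V = M \<union> U\<close> by (intro exI[of _ X]) auto
    qed
    then obtain X where X: "X \<subseteq> V \<times> V" "sym X" "\<forall>(u, v)\<in>X. s u + s v = 0"
      "\<forall>v\<in>V. card (X `` {v}) = c' v" "sparse V ((\<Union>B\<in>P - {L}. R \<inter> B \<times> B) \<union> X)"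
      by blast
    \<comment> \<open>The reserved edge is now added; it is the only link between \<open>L\<close>
      and \<open>V\<close>.\<close>
    define Q where "Q = {(x, y), (y, x)}"
    have "x \<notin> V" "y \<notin> L" using x(1) \<open>V \<inter> L = {}\<close> \<open>y \<in> V\<close> by blast+
    have "card Q \<le> 2" using card_length[of "[(x, y), (y, x)]"] by (simp add: Q_def)
    have "sparse (L \<union> V) (R \<inter> L \<times> L \<union> ((\<Union>B\<in>P - {L}. R \<inter> B \<times> B) \<union> X) \<union> Q)"
    proof (rule sparse_link)
      show "L \<inter> V = {}" using \<open>V \<inter> L = {}\<close> by blast
      show "(\<Union>B\<in>P - {L}. R \<inter> B \<times> B) \<union> X \<subseteq> V \<times> V" using X(1) unfolding V_def by blast
      show "Q \<subseteq> L \<times> V \<union> V \<times> L" using x(1) \<open>y \<in> V\<close> by (simp add: Q_def)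
    qed (fact \<open>finite L\<close> \<open>finite V\<close> sp[OF LM(1)] X(5) \<open>card Q \<le> 2\<close> Int_lower2)+
    moreover have "R \<inter> L \<times> L \<union> ((\<Union>B\<in>P - {L}. R \<inter> B \<times> B) \<union> X) \<union> Q = (\<Union>B\<in>P. R \<inter> B \<times> B) \<union> (X \<union> Q)"
      using LM by auto
    ultimately have "sparse (\<Union>P) ((\<Union>B\<in>P. R \<inter> B \<times> B) \<union> (X \<union> Q))"
      unfolding \<open>\<Union>P = L \<union> V\<close> by simp
    moreover have "card ((X \<union> Q) `` {v}) = c v" if vP: "v \<in> \<Union>P" for v
    proof -
      have fin: "finite (X `` {v})" using X(1) \<open>finite V\<close> by (auto intro: finite_subset[of _ V])
      consider "v = x" | "v = y" | "v \<noteq> x" "v \<noteq> y" "v \<in> L" | "v \<noteq> x" "v \<noteq> y" "v \<in> V"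
        using vP unfolding \<open>\<Union>P = L \<union> V\<close> by blast
      then show ?thesis
      proof cases
        case 1
        then have "(X \<union> Q) `` {v} = {y}" using X(1) \<open>x \<notin> V\<close> by (auto simp: Q_def)
        then show ?thesis using 1 x by simp
      next
        case 2
        then have "(X \<union> Q) `` {v} = insert x (X `` {v})" "x \<notin> X `` {v}"
          using X(1) \<open>x \<notin> V\<close> by (auto simp: Q_def)
        then show ?thesis using 2 fin X(4) \<open>y \<in> V\<close> y(2) by (auto simp: c'_def)
      next
        case 3
        then have "(X \<union> Q) `` {v} = {}" using X(1) \<open>V \<inter> L = {}\<close> by (auto simp: Q_def)
        then show ?thesis using 3 L0 by simp
      next
        case 4
        then have "(X \<union> Q) `` {v} = X `` {v}" by (auto simp: Q_def)
        then show ?thesis using 4 X(4) by (simp add: c'_def)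
      qed
    qed
    moreover have "sym (X \<union> Q)" using X(2) by (auto simp: Q_def sym_def)
    moreover have "X \<union> Q \<subseteq> \<Union>P \<times> \<Union>P"
      using X(1) x(1) \<open>y \<in> V\<close> unfolding \<open>\<Union>P = L \<union> V\<close> by (auto simp: Q_def)
    moreover have "\<forall>(u, v)\<in>X \<union> Q. s u + s v = 0"
      using X(3) sxy by (auto simp: Q_def)
    ultimately show ?thesis by (intro exI[of _ "X \<union> Q"]) simp
  qed
qed
section \<open>Degree sums and independent sets\<close>

text \<open>The reversal of an arc leaving \<open>S\<close> leaves the complement of
  \<open>S\<close>, and reversal is injective.\<close>

lemma independent_degree_sum_le:
  assumes "graph (with_proj F)" "independent_set (with_proj F) S"
  shows "sum (degree (with_proj F)) S \<le> sum (degree (with_proj F)) (pverts F - S)"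
proof -
  interpret pair_graph F using assms(1) by (rule pair_graphI_graph)
  have S: "S \<subseteq> pverts F" "\<And>u v. u \<in> S \<Longrightarrow> v \<in> S \<Longrightarrow> (u, v) \<notin> parcs F"
    using assms(2) by (auto simp: independent_set_def)
  have deg_sum: "sum (degree (with_proj F)) A = card {e \<in> parcs F. fst e \<in> A}" if "A \<subseteq> pverts F" for A
  proof -
    have "finite A" using that pair_finite_verts finite_subset by blast
    have "sum (degree (with_proj F)) A = (\<Sum>v\<in>A. card {e \<in> parcs F. fst e = v})"
      by (simp add: out_degree_def out_arcs_def)
    also have "\<dots> = card (\<Union>v\<in>A. {e \<in> parcs F. fst e = v})"
      using \<open>finite A\<close> pair_finite_arcs by (intro card_UN_disjoint[symmetric]) auto
    also have "(\<Union>v\<in>A. {e \<in> parcs F. fst e = v}) = {e \<in> parcs F. fst e \<in> A}" by auto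
    finally show ?thesis .
  qed
  have "prod.swap ` {e \<in> parcs F. fst e \<in> S} \<subseteq> {e \<in> parcs F. fst e \<in> pverts F - S}"
    using S(2) arcs_symmetric in_arcsD2 by fastforce
  then have "card {e \<in> parcs F. fst e \<in> S} \<le> card {e \<in> parcs F. fst e \<in> pverts F - S}"
    by (rule card_inj_on_le[rotated]) (auto simp: pair_finite_arcs)
  then show ?thesis using deg_sum S(1) by simp
qed

text \<open>This bounds the degrees outside an independent set. The two families of values are
  related only as multisets; comparing with a threshold avoids choosing a bijection between vertices
  and indices.\<close>

lemma sum_le_largest_values:
  fixes f :: "'a \<Rightarrow> nat" and d :: "nat \<Rightarrow> nat"
  assumes "finite V" "image_mset f (mset_set V) = image_mset d (mset_set {1..n})"
    and "T \<subseteq> V" "card T = k" "k \<le> n"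
    and anti: "\<And>i j. 1 \<le> i \<Longrightarrow> i \<le> j \<Longrightarrow> j \<le> n \<Longrightarrow> d j \<le> d i"
  shows "sum f T \<le> sum d {1..k}"
proof (cases "k = 0")
  case True
  then show ?thesis using assms(1,3,4) finite_subset by fastforce
next
  case False
  \<comment> \<open>Only values above the threshold \<open>d k\<close> matter: \<open>x \<le> (x - d k) + d k\<close> with truncated
    subtraction, where the truncated parts vanish beyond the \<open>k\<close> largest values.\<close>
  define t where "t = d k"
  have sum_V: "(\<Sum>v\<in>V. g (f v)) = (\<Sum>i=1..n. g (d i))" for g :: "nat \<Rightarrow> nat"
    using arg_cong[OF assms(2), of "\<lambda>M. sum_mset (image_mset g M)"]
    by (simp add: sum_unfold_sum_mset image_mset.compositionality comp_def)
  have "sum f T \<le> (\<Sum>v\<in>T. (f v - t) + t)" by (intro sum_mono) simp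
  also have "\<dots> = (\<Sum>v\<in>T. f v - t) + k * t" using assms(4) by (simp add: sum.distrib)
  also have "(\<Sum>v\<in>T. f v - t) \<le> (\<Sum>v\<in>V. f v - t)" using assms(1,3) by (intro sum_mono2) auto
  also have "(\<Sum>v\<in>V. f v - t) = (\<Sum>i=1..n. d i - t)" by (rule sum_V)
  also have "\<dots> = (\<Sum>i=1..k. d i - t)"
    using anti[of k] False assms(5) by (intro sum.mono_neutral_right) (auto simp: t_def)
  also have "(\<Sum>i=1..k. d i - t) + k * t = (\<Sum>i=1..k. (d i - t) + t)" by (simp add: sum.distrib)
  also have "\<dots> = sum d {1..k}" using anti[of _ k] assms(5) by (intro sum.cong) (auto simp: t_def)
  finally show ?thesis by simp
qed

lemma
  assumes "finite (verts G)"
  shows independence_number_attained: "\<exists>S. independent_set G S \<and> card S = independence_number G"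
    and card_le_independence_number: "independent_set G S \<Longrightarrow> card S \<le> independence_number G"
    and independence_number_le_card: "independence_number G \<le> card (verts G)"
proof -
  have "{S. independent_set G S} \<subseteq> Pow (verts G)" by (auto simp: independent_set_def)
  then have fin: "finite {S. independent_set G S}"
    using assms by (meson finite_Pow_iff finite_subset)
  have "{} \<in> {S. independent_set G S}" by (simp add: independent_set_def)
  then have "independence_number G \<in> card ` {S. independent_set G S}"
    unfolding independence_number_def using fin by (intro Max_in) auto
  then show *: "\<exists>S. independent_set G S \<and> card S = independence_number G" by auto
  show "card S \<le> independence_number G" if "independent_set G S"
    unfolding independence_number_def using fin that by (intro Max_ge) auto
  show "independence_number G \<le> card (verts G)"
    using * assms by (metis card_mono independent_set_def)
qed

section \<open>The extremal forest\<close>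

text \<open>The degrees in \<open>{m+1..n}\<close> sum to \<open>M - h\<close>. If this set is
  independent, that many edges cross, and the excess \<open>2 * h\<close> of the degrees in
  \<open>{1..m}\<close> accounts for \<open>h\<close> edges inside.\<close>

lemma forest_with_low_degree_independent_set:
  fixes d :: "nat \<Rightarrow> nat"
  assumes pos: "\<And>i. i \<in> {1..n} \<Longrightarrow> 0 < d i"
    and anti: "\<And>i j. 1 \<le> i \<Longrightarrow> i \<le> j \<Longrightarrow> j \<le> n \<Longrightarrow> d j \<le> d i"
    and total: "sum d {1..n} = 2 * M" "M + 1 \<le> n"
    and m: "1 \<le> m" "m \<le> n" "sum d {1..m} = M + h" "h < d m"
  shows "\<exists>F. undirected_forest (with_proj F) \<and> pverts F = {1..n} \<and>
    (\<forall>i\<in>{1..n}. degree (with_proj F) i = d i) \<and> independent_set (with_proj F) {m+1..n} \<and>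
    dominating_set (with_proj F) {1..m} \<and> dominating_set (with_proj F) {m+1..n} \<and>
    isolated_vertices (with_proj F \<restriction> {1..m}) = (if h = 0 then {1..m} else {1..m} - {1..h+1}) \<and>
    h + 1 \<le> m"
proof -
  have split_sum: "sum f {1..n} = sum f {1..m} + sum f {m+1..n}" for f :: "nat \<Rightarrow> nat"
    using sum.ub_add_nat[of 1 m f "n - m"] m(1,2) by simp
  \<comment> \<open>Positive low degrees give \<open>n - m \<le> M - h\<close>. With
    \<open>M + 1 \<le> n\<close> this yields \<open>h + 1 \<le> m\<close>, so the star fits into
    \<open>{1..m}\<close>.\<close>
  have "(\<Sum>i=m+1..n. 1) \<le> sum d {m+1..n}" using pos m(1) by (intro sum_mono) (auto simp: Suc_le_eq)
  then have low: "n - m \<le> sum d {m+1..n}" by simp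
  have low_eq: "sum d {m+1..n} + h = M" using split_sum[of d] total(1) m(3) by simp
  then have hm: "h + 1 \<le> m" using low total(2) m(2) by linarith
  \<comment> \<open>For \<open>h = 0\<close> the interval \<open>{2..h+1}\<close> is empty, and so
    is the star.\<close>
  define star where "star = {1} \<times> {2..h+1} \<union> {2..h+1} \<times> {1::nat}"
  \<comment> \<open>Here \<open>e\<close> is the degree within the star, \<open>c\<close> the demand
    left over and \<open>s\<close> the side. In \<open>P\<close> the vertices of the star form one
    block, all on the side of \<open>{1..m}\<close>, and every other vertex is a block of its
    own.\<close>
  define e where "e i = (if i = 1 then h else if i \<in> {2..h+1} then 1 else 0)" for i :: nat
  define c where "c i = d i - e i" for i
  define s where "s i = (if i \<le> m then 1 else - 1 :: int)" for i
  define P where "P = insert {1..h+1} ((\<lambda>i. {i}) ` {h+2..n})"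
  have dh: "h < d i" if "i \<in> {1..m}" for i
    using anti[of i m] that m by auto
  \<comment> \<open>The centre keeps a spare degree because \<open>h < d i\<close> on
    \<open>{1..m}\<close>. Leaves exist only for \<open>h\<close> at least 1, and then the same
    inequality gives them degree at least 2.\<close>
  have e_less: "e i < d i" if "i \<in> {1..n}" for i
    using dh[of i] pos[OF that] that hm by (auto simp: e_def)
  then have c_pos: "1 \<le> c i" if "i \<in> {1..n}" for i using that by (fastforce simp: c_def)
  have c_e: "c i + e i = d i" if "i \<in> {1..n}" for i using e_less[OF that] by (simp add: c_def)
  have UP: "\<Union>P = {1..n}" using hm m(2) by (auto simp: P_def)
  have sum_e: "sum e A = 2 * h" if "A = {1..m} \<or> A = {1..n}" for A
  proof -
    have "sum e A = sum e (insert 1 {2..h+1})"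
      using that hm m(2) by (intro sum.mono_neutral_right) (auto simp: e_def)
    also have "\<dots> = 2 * h" by (simp add: e_def)
    finally show ?thesis .
  qed
  have sum_ce: "sum c A + sum e A = sum d A" if "A \<subseteq> {1..n}" for A
    unfolding sum.distrib[symmetric] using that c_e by (intro sum.cong) auto
  have c_all: "sum c {1..n} + 2 * h = 2 * M" using sum_ce[of "{1..n}"] sum_e total by simp
  have c_top: "sum c {1..m} + 2 * h = M + h" using sum_ce[of "{1..m}"] sum_e m by simp
  have "\<exists>X. X \<subseteq> \<Union>P \<times> \<Union>P \<and> sym X \<and> (\<forall>(u, v)\<in>X. s u + s v = 0) \<and>
    (\<forall>v\<in>\<Union>P. card (X `` {v}) = c v) \<and> sparse (\<Union>P) ((\<Union>B\<in>P. star \<inter> B \<times> B) \<union> X)"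
  proof (rule bipartite_completion)
    show "finite P" "\<And>B. B \<in> P \<Longrightarrow> finite B" by (auto simp: P_def)
    show "pairwise disjnt P" by (auto simp: P_def pairwise_def disjnt_def)
    show "sparse B (star \<inter> B \<times> B)" if "B \<in> P" for B
    proof -
      have "finite B" using that by (auto simp: P_def)
      then have "sparse B star" unfolding star_def by (intro sparse_star) auto
      moreover have "star \<inter> B \<times> B \<inter> W \<times> W = star \<inter> W \<times> W" if "W \<subseteq> B" for W
        using that by blast
      ultimately show ?thesis unfolding sparse_def by simp
    qed
    show "s u = s v" if "B \<in> P" "u \<in> B" "v \<in> B" for B u v
      using that hm by (auto simp: P_def s_def)
    show "\<bar>s v\<bar> = 1" for v by (simp add: s_def)
    show "1 \<le> sum c B" if "B \<in> P" for B
    proof -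
      have B: "finite B" "B \<noteq> {}" "B \<subseteq> {1..n}" using that UP by (auto simp: P_def)
      then obtain b where "b \<in> B" by blast
      then show ?thesis using c_pos[of b] member_le_sum[of b B c] B by force
    qed
    \<comment> \<open>Both sides have total demand \<open>M - h\<close>.\<close>
    show "(\<Sum>v\<in>\<Union>P. s v * int (c v)) = 0"
    proof -
      have "{1..n} = {1..m} \<union> {m+1..n}" using m by auto
      then have "(\<Sum>v\<in>{1..n}. s v * int (c v))
          = (\<Sum>v\<in>{1..m}. s v * int (c v)) + (\<Sum>v\<in>{m+1..n}. s v * int (c v))"
        by (simp add: sum.union_disjoint)
      also have "(\<Sum>v\<in>{1..m}. s v * int (c v)) = int (sum c {1..m})" by (simp add: s_def)
      also have "(\<Sum>v\<in>{m+1..n}. s v * int (c v)) = - int (sum c {m+1..n})"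
        by (simp add: s_def sum_negf)
      finally show ?thesis
        using c_all c_top split_sum[of c] unfolding UP by linarith
    qed
    \<comment> \<open>There are \<open>n - h\<close> blocks and the total demand is
      \<open>2 * M - 2 * h\<close>, so this is the hypothesis \<open>M + 1 \<le> n\<close>.\<close>
    show "sum c (\<Union>P) + 2 \<le> 2 * card P"
    proof -
      have "{1..h+1} \<notin> (\<lambda>i. {i}) ` {h+2..n}"
      proof
        assume "{1..h+1} \<in> (\<lambda>i. {i}) ` {h+2..n}"
        then obtain i where "{1..h+1} = {i}" "h + 2 \<le> i" by auto
        moreover have "h + 1 \<in> {1..h+1}" by simp
        ultimately show False by auto
      qed
      then have "card P = Suc (n - (h + 1))" by (simp add: P_def card_image)
      then show ?thesis using c_all total(2) hm m(2) unfolding UP by linarith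
    qed
  qed
  moreover have "(\<Union>B\<in>P. star \<inter> B \<times> B) = star"
  proof
    have "star \<subseteq> {1..h+1} \<times> {1..h+1}" by (auto simp: star_def)
    then show "star \<subseteq> (\<Union>B\<in>P. star \<inter> B \<times> B)" by (auto simp: P_def)
  qed auto
  ultimately obtain X where X: "X \<subseteq> {1..n} \<times> {1..n}" "sym X" "\<And>u v. (u, v) \<in> X \<Longrightarrow> s u + s v = 0"
    "\<And>v. v \<in> {1..n} \<Longrightarrow> card (X `` {v}) = c v" "sparse {1..n} (star \<union> X)"
    unfolding UP by fastforce
  define F where "F = \<lparr>pverts = {1..n}, parcs = star \<union> X\<rparr>"
  have F: "pverts F = {1..n}" "parcs F = star \<union> X" by (simp_all add: F_def)
  have star_sub: "star \<subseteq> {1..m} \<times> {1..m}" using hm by (auto simp: star_def)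
  have X_cross: "u \<le> m \<longleftrightarrow> m < v" if "(u, v) \<in> X" for u v
    using X(3)[OF that] by (auto simp: s_def split: if_splits)
  have sub: "parcs F \<subseteq> {1..n} \<times> {1..n}" using star_sub X(1) m(2) by (fastforce simp: F)
  have finF: "finite (parcs F)" using sub finite_subset by blast
  have sym_star: "sym star" by (auto simp: star_def sym_def)
  have symF: "sym (parcs F)" using sym_star X(2) by (auto simp: F sym_def)
  have loopfree: "u \<noteq> v" if "(u, v) \<in> parcs F" for u v
    using that X_cross[of u v] by (auto simp: F star_def)
  have "pair_graph F"
  proof unfold_locales
    show "symmetric (with_proj F)" using symF by (simp add: symmetric_def)
  qed (use sub finF loopfree in \<open>auto simp: F(1)\<close>)
  then have graphF: "graph (with_proj F)" by (rule pair_graph.pair_graphD_graph)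
  have forest: "undirected_forest (with_proj F)"
    using sparse_imp_no_long_cycle[of F] symF X(5) finF sub graphF
    unfolding undirected_forest_def F by fastforce
  have card_star: "card (star `` {i}) = e i" for i
  proof -
    have "star `` {i} = (if i = 1 then {2..h+1} else if i \<in> {2..h+1} then {1} else {})"
      by (auto simp: star_def)
    then show ?thesis by (simp add: e_def)
  qed
  have deg: "degree (with_proj F) i = d i" if "i \<in> {1..n}" for i
  proof -
    have "{a \<in> parcs F. fst a = i} = Pair i ` (star `` {i} \<union> X `` {i})" by (auto simp: F)
    then have "degree (with_proj F) i = card (star `` {i} \<union> X `` {i})"
      by (simp add: out_degree_def out_arcs_def card_image inj_on_def)
    also have "\<dots> = card (star `` {i}) + card (X `` {i})"
    proof (rule card_Un_disjoint)
      show "finite (star `` {i})" "finite (X `` {i})"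
        using finF by (auto simp: F)
      show "star `` {i} \<inter> X `` {i} = {}"
        using star_sub X_cross by fastforce
    qed
    finally show ?thesis using card_star X(4)[OF that] c_e[OF that] by simp
  qed
  \<comment> \<open>Positive demand gives every vertex a neighbor across the partition; this is what
    makes both sides dominating.\<close>
  have X_nbr: "\<exists>v\<in>{1..n}. (u, v) \<in> X" if "u \<in> {1..n}" for u
  proof -
    have "X `` {u} \<noteq> {}" using X(4)[OF that] c_pos[OF that] by auto
    then show ?thesis using X(1) by blast
  qed
  have "(u, v) \<notin> parcs F" if "m < u" "m < v" for u v
    using that star_sub X_cross[of u v] by (auto simp: F)
  then have indep: "independent_set (with_proj F) {m+1..n}"
    by (auto simp: independent_set_def F(1))
  have nbr: "\<exists>v\<in>{1..n}. (u, v) \<in> parcs F \<and> (u \<le> m \<longleftrightarrow> m < v)" if "u \<in> {1..n}" for u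
    using X_nbr[OF that] X_cross unfolding F(2) by blast
  have dom1: "dominating_set (with_proj F) {1..m}"
    unfolding dominating_set_def with_proj_simps F(1)
  proof (intro conjI ballI)
    fix u assume "u \<in> {1..n} - {1..m}"
    then show "\<exists>v\<in>{1..m}. (u, v) \<in> parcs F" using nbr[of u] by force
  qed (use m(2) in auto)
  have dom2: "dominating_set (with_proj F) {m+1..n}"
    unfolding dominating_set_def with_proj_simps F(1)
  proof (intro conjI ballI)
    fix u assume "u \<in> {1..n} - {m+1..n}"
    then show "\<exists>v\<in>{m+1..n}. (u, v) \<in> parcs F" using nbr[of u] by force
  qed auto
  \<comment> \<open>All arcs of \<open>X\<close> cross, so only the star survives in the induced
    subgraph.\<close>
  have "degree (with_proj F \<restriction> {1..m}) u = 0 \<longleftrightarrow> h = 0 \<or> u \<notin> {1..h+1}" if u: "u \<in> {1..m}" for u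
  proof -
    have "out_arcs (with_proj F \<restriction> {1..m}) u = Pair u ` (star `` {u})"
    proof
      show "out_arcs (with_proj F \<restriction> {1..m}) u \<subseteq> Pair u ` (star `` {u})"
        using X_cross[of u] by (force simp: F)
      show "Pair u ` (star `` {u}) \<subseteq> out_arcs (with_proj F \<restriction> {1..m}) u"
        using u star_sub by (auto simp: F)
    qed
    then have "degree (with_proj F \<restriction> {1..m}) u = e u"
      using card_star by (simp add: out_degree_def card_image inj_on_def)
    then show ?thesis using u by (auto simp: e_def)
  qed
  then have "isolated_vertices (with_proj F \<restriction> {1..m}) = (if h = 0 then {1..m} else {1..m} - {1..h+1})"
    by (auto simp: isolated_vertices_def)
  then show ?thesis using forest F(1) deg indep dom1 dom2 hm by blast
qed

section \<open>Identification of \<open>k\<close> with the degree-sum threshold\<close>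

theorem theorem4:
  fixes n k :: nat and d :: "nat \<Rightarrow> nat"
  assumes "\<And>i. i \<in> {1..n} \<Longrightarrow> 0 < d i"
    and "\<And>i j. 1 \<le> i \<Longrightarrow> i \<le> j \<Longrightarrow> j \<le> n \<Longrightarrow> d j \<le> d i"
    and "even (\<Sum>i=1..n. d i)"
    and "int (\<Sum>i=1..n. d i) \<le> 2 * int n - 2"
    and "int (alpha_max n d) = int n - int k"
  shows "\<exists>F :: nat pair_pre_digraph.
    undirected_forest (with_proj F) \<and> pverts F = {1..n} \<and>
    (\<forall>i\<in>{1..n}. degree (with_proj F) i = d i) \<and>
    independent_set (with_proj F) {k+1..n} \<and>
    dominating_set (with_proj F) {1..k} \<and> dominating_set (with_proj F) {k+1..n} \<and>
    (\<forall>r\<le>k. card (isolated_vertices (with_proj F \<restriction> {1..k})) = r \<longrightarrow>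
       isolated_vertices (with_proj F \<restriction> {1..k}) = {1..k} - {1..k-r})"
proof -
  obtain M where M: "sum d {1..n} = 2 * M" using assms(3) by (auto elim: evenE)
  then have "M + 1 \<le> n" using assms(4) by linarith
  have kn: "k \<le> n" "alpha_max n d + k = n" using assms(5) by linarith+
  define m where "m = (LEAST j. M \<le> sum d {1..j})"
  have m_ge: "M \<le> sum d {1..m}" unfolding m_def by (rule LeastI[of _ n]) (use M in simp)
  have m_least: "m \<le> j" if "M \<le> sum d {1..j}" for j unfolding m_def using that by (rule Least_le)
  have "m \<le> n" by (rule m_least) (use M in simp)
  have "0 < sum d {1..n}" using assms(1)[of 1] \<open>M + 1 \<le> n\<close> by (intro sum_pos2[of _ 1]) auto
  then have "M > 0" using M by simp
  then have "m \<noteq> 0" using m_ge by (cases m) auto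
  then obtain j where j: "m = Suc j" by (cases m) auto
  \<comment> \<open>By minimality of \<open>m\<close>, the last summand \<open>d m\<close> carries
    the sum from below \<open>M\<close> to \<open>M + h\<close>, whence
    \<open>h < d m\<close>.\<close>
  have "sum d {1..j} < M" using m_least[of j] j by (meson Suc_n_not_le_n not_le)
  define h where "h = sum d {1..m} - M"
  have "1 \<le> m" "sum d {1..m} = M + h" "h < d m"
    using \<open>sum d {1..j} < M\<close> j m_ge by (simp_all add: h_def)
  have "\<exists>F. undirected_forest (with_proj F) \<and> pverts F = {1..n} \<and>
    (\<forall>i\<in>{1..n}. degree (with_proj F) i = d i) \<and> independent_set (with_proj F) {m+1..n} \<and>
    dominating_set (with_proj F) {1..m} \<and> dominating_set (with_proj F) {m+1..n} \<and>
    isolated_vertices (with_proj F \<restriction> {1..m}) = (if h = 0 then {1..m} else {1..m} - {1..h+1}) \<and>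
    h + 1 \<le> m"
    by (rule forest_with_low_degree_independent_set) fact+
  then obtain F where F: "undirected_forest (with_proj F)" "pverts F = {1..n}"
    "\<forall>i\<in>{1..n}. degree (with_proj F) i = d i"
    "independent_set (with_proj F) {m+1..n}"
    "dominating_set (with_proj F) {1..m}" "dominating_set (with_proj F) {m+1..n}"
    "isolated_vertices (with_proj F \<restriction> {1..m}) = (if h = 0 then {1..m} else {1..m} - {1..h+1})"
    "h + 1 \<le> m"
    by blast
  have forestsD: "finite (pverts G)" "card (pverts G) = n" "graph (with_proj G)"
    "image_mset (degree (with_proj G)) (mset_set (pverts G)) = image_mset d (mset_set {1..n})"
    if "G \<in> forests_of n d" for G
  proof -
    show g: "graph (with_proj G)" and
      ms: "image_mset (degree (with_proj G)) (mset_set (pverts G)) = image_mset d (mset_set {1..n})"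
      using that by (auto simp: forests_of_def undirected_forest_def)
    interpret pair_graph G using g by (rule pair_graphI_graph)
    show "finite (pverts G)" by (rule pair_finite_verts)
    show "card (pverts G) = n" using arg_cong[OF ms, of size] by simp
  qed
  have "image_mset (degree (with_proj F)) (mset_set (pverts F)) = image_mset d (mset_set {1..n})"
    unfolding F(2) using F(3) by (intro image_mset_cong) auto
  then have F_in: "F \<in> forests_of n d" using F(1) by (simp add: forests_of_def)
  let ?\<alpha> = "(\<lambda>G. independence_number (with_proj G)) ` forests_of n d"
  have "independence_number (with_proj G) \<le> n" if "G \<in> forests_of n d" for G
    using independence_number_le_card[of "with_proj G"] forestsD(1,2)[OF that] by simp
  then have "?\<alpha> \<subseteq> {..n}" by auto
  then have fin: "finite ?\<alpha>" using finite_subset by blast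
  \<comment> \<open>The constructed forest bounds the maximum from below, which gives
    \<open>k \<le> m\<close>.\<close>
  have "n - m = card {m+1..n}" by simp
  also have "\<dots> \<le> independence_number (with_proj F)"
    using card_le_independence_number[OF _ F(4)] F(2) by simp
  also have "\<dots> \<le> alpha_max n d"
    unfolding alpha_max_def using fin F_in by (intro Max_ge) auto
  finally have "k \<le> m" using kn by linarith
  \<comment> \<open>For the converse, a forest \<open>G\<close> attaining the maximum has an
    independent set missing only \<open>k\<close> vertices. Their degrees sum to at least
    \<open>M\<close>, hence so do the \<open>k\<close> largest, and \<open>m \<le> k\<close>
    follows.\<close>
  have "alpha_max n d \<in> ?\<alpha>" unfolding alpha_max_def using fin F_in by (intro Max_in) auto
  then obtain G where G: "G \<in> forests_of n d" "independence_number (with_proj G) = alpha_max n d" by auto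
  then obtain S where S: "independent_set (with_proj G) S" "card S = alpha_max n d"
    using independence_number_attained[of "with_proj G"] forestsD(1)[OF G(1)] by auto
  have "S \<subseteq> pverts G" using S(1) by (simp add: independent_set_def)
  have fS: "finite S" using \<open>S \<subseteq> pverts G\<close> forestsD(1)[OF G(1)] finite_subset by blast
  let ?deg = "degree (with_proj G)"
  have "card (pverts G - S) = k"
    using \<open>S \<subseteq> pverts G\<close> fS S(2) forestsD(2)[OF G(1)] kn by (simp add: card_Diff_subset)
  then have "sum ?deg (pverts G - S) \<le> sum d {1..k}"
    using sum_le_largest_values[OF forestsD(1,4)[OF G(1)] _ _ kn(1)] assms(2) by blast
  moreover have "sum ?deg S \<le> sum ?deg (pverts G - S)"
    by (rule independent_degree_sum_le[OF forestsD(3)[OF G(1)] S(1)])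
  moreover have "sum ?deg (pverts G) = sum ?deg (pverts G - S) + sum ?deg S"
    by (rule sum.subset_diff[OF \<open>S \<subseteq> pverts G\<close> forestsD(1)[OF G(1)]])
  moreover have "sum ?deg (pverts G) = 2 * M"
    using arg_cong[OF forestsD(4)[OF G(1)], of sum_mset] M by (simp add: sum_unfold_sum_mset)
  ultimately have "M \<le> sum d {1..k}" by linarith
  then have "m = k" using m_least[of k] \<open>k \<le> m\<close> by simp
  \<comment> \<open>With \<open>r\<close> isolated vertices, \<open>k - r\<close> is 0 if
    \<open>h = 0\<close> and \<open>h + 1\<close> otherwise, the number of vertices of the
    star.\<close>
  have "isolated_vertices (with_proj F \<restriction> {1..k})
      = {1..k} - {1..k - card (isolated_vertices (with_proj F \<restriction> {1..k}))}"
    using F(7,8) unfolding \<open>m = k\<close> by (auto simp: card_Diff_subset)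
  then show ?thesis using F(1-6) unfolding \<open>m = k\<close> by blast
qed

end
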